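(* Let $\mathbf{B}\in\mathbb{C}^{n\times n}$ be a $\delta$-regular pseudo-adjacency matrix for a directed graph $\mathcal{G}$ with $n$ nodes. Let $\mathbf{B}$ be decomposed as $\mathbf{B}=\mathbf{U}\,\mathrm{diag}\{\boldsymbol{\lambda}(\mathbf{B})\}\,\mathbf{V}^{*}$ where $\mathbf{U}\mathbf{V}^{*}=\mathbf{I}$. Let $\lambda_{\ell}(\mathbf{B})=\alpha_{\ell}e^{i\theta_{\ell}}$, with $\alpha_{\ell}\in\mathbb{R}$ and $\theta_{\ell}\in[0,2\pi)$, be a polar form of the $\ell$-th eigenvalue of $\mathbf{B}$, and let $\boldsymbol{\alpha}(\mathbf{B})=(\alpha_{0},\dots,\alpha_{n-1})$. Let $\mathbf{f},\mathbf{g}\in\{0,1\}^{n\times1}$ be such that there exist $\mathbf{F},\mathbf{G}\in\mathbb{C}^{n\times1}$ satisfying $$\mathbf{f}=\mathbf{V}\overline{\mathbf{F}},\qquad \mathbf{g}=\mathbf{U}\mathbf{G},\qquad\text{such that for all }0\le\ell<n,\ \ \mathbf{F}[\ell]\mathbf{G}[\ell]e^{i\theta_{\ell}}\ge0.$$ Then if $\mathbf{f}$ and $\mathbf{g}$ denote respectively indicator vectors for rows and columns associated with a rectangular zero block in $\mathbf{B}$, $$\frac{\|\mathbf{f}\|_{2}^{2}\,\|\mathbf{g}\|_{2}^{2}}{n}\le\frac{-\min\{\boldsymbol{\alpha}(\mathbf{B})\}\sum_{0\le\ell<n}\mathbf{F}[\ell]\mathbf{G}[\ell]e^{i\theta_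{\ell}}}{\delta-\min\{\boldsymbol{\alpha}(\mathbf{B})\}}.$$
   Context: A matrix $\mathbf{B}\in\mathbb{C}^{n\times n}$ is a pseudo-adjacency matrix for a directed graph $\mathcal{G}$ with $n$ nodes if $\mathbf{B}[i,j]=0$ whenever there is no directed edge from the $i$-th node to the $j$-th node in $\mathcal{G}$. It is $\delta$-regular if all row sums and all column sums of $\mathbf{B}$ are equal to $\delta$. In the decomposition, $\mathbf{U},\mathbf{V}\in\mathbb{C}^{n\times n}$ and $\boldsymbol{\lambda}(\mathbf{B})=(\lambda_\ell(\mathbf{B}))_{0\le\ell<n}\subset\mathbb{C}$ is the tuple of eigenvalues of $\mathbf{B}$. The vectors $\mathbf{f},\mathbf{g}\in\{0,1\}^{n\times 1}$ are indicator vectors for rows and columns associated with a rectangular zero block in $\mathbf{B}$ if $\mathbf{B}[i,j]=0$ whenever $\mathbf{f}[i]=1$ and $\mathbf{g}[j]=1$. Indices run over $0,\dots,n-1$; $^{*}$ is conjugate transpose; $\overline{\mathbf{F}}$ is the entrywise conjugate; $\mathrm{diag}\{\boldsymbol{\lambda}\}$ is the diagonal matrix with $\ell$-th diagonal entry $\lambda_\ell$; $\mathbf{I}$ is the identity matrix; for a complex number, "$\ge 0$" means real and nonnegative.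
   Formalization: Assumes also that some column of U and the same-index column of V are multiples of the all-ones vector (automatic if δ is a simple eigenvalue; false without it, e.g. two disjoint edges), and that n > 0 and δ ≠ min α. *)

theory Defs
  imports
    "HOL-Analysis.L2_Norm"
    "HOL-Library.Complex_Order"
    "Jordan_Normal_Form.Char_Poly"
    "Jordan_Normal_Form.Schur_Decomposition"
    "Graph_Theory.Digraph"
begin

(* Conventions: matrices and vectors are those of Jordan_Normal_Form, indexed from 0.
   On complex, x \<le> y means that Im x = Im y and Re x \<le> Re y (HOL-Library.Complex_Order);
   in particular 0 \<le> x says that x is real and nonnegative. *)

(* The enumeration nd fixes which vertex is "the i-th node".  Loops and parallel arcs are
   allowed in G; parallel arcs make no difference. *)
definition pseudo_adjacency ::
    "nat \<Rightarrow> ('v, 'e) pre_digraph \<Rightarrow> (nat \<Rightarrow> 'v) \<Rightarrow> complex mat \<Rightarrow> bool" where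
  "pseudo_adjacency n G nd B \<longleftrightarrow>
     B \<in> carrier_mat n n \<and> bij_betw nd {..<n} (verts G) \<and>
     (\<forall>i<n. \<forall>j<n. \<not> (nd i \<rightarrow>\<^bsub>G\<^esub> nd j) \<longrightarrow> B $$ (i, j) = 0)"

definition regular_mat :: "nat \<Rightarrow> complex \<Rightarrow> complex mat \<Rightarrow> bool" where
  "regular_mat n \<delta> B \<longleftrightarrow>
     (\<forall>i<n. (\<Sum>j<n. B $$ (i, j)) = \<delta>) \<and> (\<forall>j<n. (\<Sum>i<n. B $$ (i, j)) = \<delta>)"

definition indicator_vec :: "nat \<Rightarrow> complex vec \<Rightarrow> bool" where
  "indicator_vec n f \<longleftrightarrow> f \<in> carrier_vec n \<and> (\<forall>i<n. f $ i \<in> {0, 1})"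

definition zero_block :: "nat \<Rightarrow> complex mat \<Rightarrow> complex vec \<Rightarrow> complex vec \<Rightarrow> bool" where
  "zero_block n B f g \<longleftrightarrow> (\<forall>i<n. \<forall>j<n. f $ i = 1 \<and> g $ j = 1 \<longrightarrow> B $$ (i, j) = 0)"

definition norm2 :: "complex vec \<Rightarrow> real" where
  "norm2 x = L2_set (\<lambda>i. cmod (x $ i)) {..<dim_vec x}"

(* lam lists the eigenvalues of B with algebraic multiplicity. *)
definition eigenvalue_tuple :: "nat \<Rightarrow> complex mat \<Rightarrow> (nat \<Rightarrow> complex) \<Rightarrow> bool" where
  "eigenvalue_tuple n B lam \<longleftrightarrow> char_poly B = (\<Prod>l<n. [:- lam l, 1:])"

(* For a regular B the all-ones vector is both a right and a left eigenvector for \<delta>.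
   The decomposition B = U diag(lam) V^* is required to display this pair: some column of U and
   the column of V with the same index are multiples of the all-ones vector.  This is automatic
   when \<delta> is a simple eigenvalue.  When \<delta> is a multiple eigenvalue the bases of its
   left and right eigenspaces can be chosen otherwise, and then the zero block bound can fail:
   let B be the adjacency matrix of two disjoint (bidirected) edges, U = V with columns
   (1,1,0,0), (0,0,1,1), (1,-1,0,0), (0,0,1,-1), each divided by sqrt 2, alpha = lam = (1,1,-1,-1),
   f = (1,1,0,0) and g = (0,0,1,1); then F[l] G[l] = 0 for all l, so the bound would read
   1 \<le> 0. *)
definition has_ones_pair :: "nat \<Rightarrow> complex mat \<Rightarrow> complex mat \<Rightarrow> bool" where
  "has_ones_pair n U V \<longleftrightarrow>
     (\<exists>k<n. \<exists>a b. col U k = a \<cdot>\<^sub>v vec n (\<lambda>_. 1) \<and> col V k = b \<cdot>\<^sub>v vec n (\<lambda>_. 1))"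

end

theory Submission
  imports Defs
begin

text \<open>
  The argument is that of Hoffman's ratio bound, with a diagonalization by two dual bases in place
  of an orthonormal eigenbasis and with a rectangular zero block in place of an independent set.
  Since \<open>V\<^sup>*\<close> inverts \<open>U\<close>, the columns of \<open>U\<close> and of \<open>V\<close> are dual to each other.  The \<open>G l\<close> are
  the coefficients of \<open>g\<close> in the columns of \<open>U\<close>, and, as \<open>f\<close> is real, the \<open>F l\<close> are those of \<open>f\<close> in
  the conjugated columns of \<open>V\<close>.  These bases diagonalize the form \<open>(f, g) \<mapsto> f\<^sup>T B g\<close>.  The zero
  block makes this form vanish, so \<open>\<Sum>l. \<alpha> l * w l = 0\<close> with the nonnegative weights
  \<open>w l = F l * G l * exp (\<i> * \<theta> l)\<close> (lemma \<open>spectral_bilinear_form\<close>).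

  At the index \<open>k\<close> of the all-ones pair, regularity forces \<open>lam k = \<delta>\<close>
  (lemma \<open>constant_column_eigenvalue\<close>), and biorthogonality fixes
  the product of the two scaling factors, so that \<open>F k * G k = \<bar>f\<bar> \<bar>g\<bar> / n\<close> whatever the scaling,
  where \<open>\<bar>f\<bar>\<close> and \<open>\<bar>g\<bar>\<close> are the numbers of ones.  Isolating this term
  and bounding every other \<open>\<alpha> l\<close> below by the minimum \<open>m\<close> gives
  \<open>(\<alpha> k - m) * w k \<le> - m * (\<Sum>l. w l)\<close> (lemma \<open>weighted_sum_zero_bound\<close>).

  It remains to see that \<open>\<alpha> k\<close> is \<open>\<delta>\<close> and that \<open>w k\<close> is \<open>\<bar>f\<bar> \<bar>g\<bar> / n\<close>.  If neither \<open>f\<close> nor \<open>g\<close>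
  vanishes, \<open>F k * G k\<close> is positive, so the nonnegativity of \<open>w k\<close> leaves \<open>1\<close> as the only possible
  phase; in particular \<open>\<delta>\<close> is real.  If \<open>f\<close> or \<open>g\<close> vanishes, \<open>\<delta>\<close> may be nonreal, but then all
  weights are zero and both sides of the bound are zero.
\<close>

section \<open>Diagonalization by dual bases\<close>

definition biorthogonal :: "nat \<Rightarrow> (nat \<Rightarrow> nat \<Rightarrow> complex) \<Rightarrow> (nat \<Rightarrow> nat \<Rightarrow> complex) \<Rightarrow> bool" where
  "biorthogonal n u v \<longleftrightarrow>
     (\<forall>l<n. \<forall>m<n. (\<Sum>i<n. cnj (v i l) * u i m) = (if l = m then 1 else 0))"

text \<open>
  Pairing with the dual basis reads off coefficients: of the terms of \<open>g\<close>, only the one along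
  column \<open>l\<close> survives.
\<close>

lemma biorthogonal_coefficient:
  assumes uv: "biorthogonal n u v" and l: "l < n"
    and g: "\<And>i. i < n \<Longrightarrow> g i = (\<Sum>m<n. u i m * G m)"
  shows "(\<Sum>i<n. cnj (v i l) * g i) = G l"
proof -
  have "(\<Sum>i<n. cnj (v i l) * g i) = (\<Sum>i<n. \<Sum>m<n. cnj (v i l) * u i m * G m)"
    by (intro sum.cong) (simp_all add: g sum_distrib_left mult.assoc)
  also have "\<dots> = (\<Sum>m<n. (\<Sum>i<n. cnj (v i l) * u i m) * G m)"
    unfolding sum_distrib_right by (rule sum.swap)
  also have "\<dots> = (\<Sum>m<n. if l = m then G m else 0)"
    using uv l by (intro sum.cong) (auto simp: biorthogonal_def)
  also have "\<dots> = G l"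
    using l by simp
  finally show ?thesis .
qed

lemma biorthogonal_swap:
  assumes "biorthogonal n u v"
  shows "biorthogonal n v u"
  unfolding biorthogonal_def
proof (intro allI impI)
  fix l m assume "l < n" "m < n"
  have "(\<Sum>i<n. cnj (u i l) * v i m) = cnj (\<Sum>i<n. cnj (v i m) * u i l)"
    by (simp add: mult.commute)
  also have "\<dots> = (if l = m then 1 else 0)"
    using assms \<open>l < n\<close> \<open>m < n\<close> by (auto simp: biorthogonal_def)
  finally show "(\<Sum>i<n. cnj (u i l) * v i m) = (if l = m then 1 else 0)" .
qed

text \<open>
  The factorization acts on \<open>g\<close> by scaling its coefficients.  For \<open>g\<close> a column of \<open>u\<close> this is the
  eigenvalue equation.
\<close>

lemma spectral_apply:
  assumes uv: "biorthogonal n u v"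
    and B: "\<And>i j. i < n \<Longrightarrow> j < n \<Longrightarrow> B i j = (\<Sum>l<n. u i l * lam l * cnj (v j l))"
    and g: "\<And>i. i < n \<Longrightarrow> g i = (\<Sum>m<n. u i m * G m)"
    and i: "i < n"
  shows "(\<Sum>j<n. B i j * g j) = (\<Sum>l<n. u i l * lam l * G l)"
proof -
  have "(\<Sum>j<n. B i j * g j) = (\<Sum>j<n. \<Sum>l<n. u i l * lam l * (cnj (v j l) * g j))"
    using i by (intro sum.cong) (simp_all add: B sum_distrib_right mult.assoc)
  also have "\<dots> = (\<Sum>l<n. u i l * lam l * (\<Sum>j<n. cnj (v j l) * g j))"
    unfolding sum_distrib_left by (rule sum.swap)
  also have "\<dots> = (\<Sum>l<n. u i l * lam l * G l)"
    using biorthogonal_coefficient[OF uv _ g] by (intro sum.cong) simp_all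
  finally show ?thesis .
qed

lemma spectral_bilinear_form:
  assumes uv: "biorthogonal n u v"
    and B: "\<And>i j. i < n \<Longrightarrow> j < n \<Longrightarrow> B i j = (\<Sum>l<n. u i l * lam l * cnj (v j l))"
    and g: "\<And>i. i < n \<Longrightarrow> g i = (\<Sum>m<n. u i m * G m)"
    and F: "\<And>l. l < n \<Longrightarrow> F l = (\<Sum>i<n. u i l * f i)"
  shows "(\<Sum>i<n. \<Sum>j<n. f i * B i j * g j) = (\<Sum>l<n. F l * G l * lam l)"
proof -
  have "(\<Sum>i<n. \<Sum>j<n. f i * B i j * g j) = (\<Sum>i<n. f i * (\<Sum>j<n. B i j * g j))"
    by (simp add: sum_distrib_left mult.assoc)
  also have "\<dots> = (\<Sum>i<n. \<Sum>l<n. u i l * f i * (G l * lam l))"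
  proof (intro sum.cong refl)
    fix i assume "i \<in> {..<n}"
    hence "(\<Sum>j<n. B i j * g j) = (\<Sum>l<n. u i l * lam l * G l)"
      using spectral_apply[where B = B and lam = lam and g = g and G = G, OF uv B g] by simp
    thus "f i * (\<Sum>j<n. B i j * g j) = (\<Sum>l<n. u i l * f i * (G l * lam l))"
      by (simp add: sum_distrib_left mult_ac)
  qed
  also have "\<dots> = (\<Sum>l<n. (\<Sum>i<n. u i l * f i) * (G l * lam l))"
    unfolding sum_distrib_right by (rule sum.swap)
  also have "\<dots> = (\<Sum>l<n. F l * G l * lam l)"
    by (intro sum.cong) (simp_all add: F mult.assoc)
  finally show ?thesis .
qed

text \<open>
  Applying \<open>B\<close> to a nonzero constant vector multiplies it by the common row sum, while applying
  it to column \<open>k\<close> of \<open>u\<close> multiplies that column by \<open>lam k\<close>; a single row suffices to compare the two.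
\<close>

lemma constant_column_eigenvalue:
  assumes uv: "biorthogonal n u v"
    and B: "\<And>i j. i < n \<Longrightarrow> j < n \<Longrightarrow> B i j = (\<Sum>l<n. u i l * lam l * cnj (v j l))"
    and rows: "\<And>i. i < n \<Longrightarrow> (\<Sum>j<n. B i j) = \<delta>"
    and k: "k < n" and u: "\<And>i. i < n \<Longrightarrow> u i k = a" and "a \<noteq> 0"
  shows "lam k = \<delta>"
proof -
  have unit: "(\<Sum>m<n. c m * (if m = k then 1 else 0)) = c k" for c :: "nat \<Rightarrow> complex"
    using k by (simp add: if_distrib cong: if_cong)
  have "(\<Sum>j<n. B k j * u j k) = (\<Sum>l<n. u k l * lam l * (if l = k then 1 else 0))"
    by (rule spectral_apply[where B = B and lam = lam and G = "\<lambda>l. if l = k then 1 else 0", OF uv B])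
      (simp_all add: k unit)
  also have "\<dots> = a * lam k"
    using k by (simp only: unit u)
  also have "(\<Sum>j<n. B k j * u j k) = \<delta> * a"
    using k by (simp add: u flip: rows sum_distrib_right)
  finally show ?thesis
    using \<open>a \<noteq> 0\<close> by simp
qed

section \<open>Weights and phases\<close>

text \<open>
  A vanishing weighted sum balances the term at \<open>k\<close> against the remaining weights, each of which
  is multiplied by at least \<open>m\<close>.
\<close>

lemma weighted_sum_zero_bound:
  fixes \<alpha> w :: "'a \<Rightarrow> real"
  assumes "finite A" and "k \<in> A"
    and w: "\<And>l. l \<in> A \<Longrightarrow> 0 \<le> w l" and m: "\<And>l. l \<in> A \<Longrightarrow> m \<le> \<alpha> l"
    and zero: "(\<Sum>l\<in>A. \<alpha> l * w l) = 0"
  shows "(\<alpha> k - m) * w k \<le> - m * (\<Sum>l\<in>A. w l)"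
proof -
  have "(\<alpha> k - m) * w k \<le> (\<Sum>l\<in>A. (\<alpha> l - m) * w l)"
    using assms by (intro member_le_sum) (simp_all add: mult_nonneg_nonneg)
  also have "\<dots> = - m * (\<Sum>l\<in>A. w l)"
    using zero by (simp add: left_diff_distrib sum_subtractf sum_distrib_left sum_negf)
  finally show ?thesis .
qed

lemma unimodular_eq_1_if_positive_multiple_nonneg:
  fixes z :: complex
  assumes "cmod z = 1" and "c > 0" and nonneg: "0 \<le> complex_of_real c * z"
  shows "z = 1"
proof -
  have "0 \<le> z"
    using \<open>c > 0\<close> nonneg by (auto simp: less_eq_complex_def zero_le_mult_iff)
  hence "z = complex_of_real (cmod z)"
    by (auto simp: less_eq_complex_def complex_eq_iff cmod_eq_Re)
  thus ?thesis
    using \<open>cmod z = 1\<close> by simp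
qed

section \<open>Entries of vectors and matrices\<close>

lemma norm2_indicator_vec:
  assumes "indicator_vec n f"
  shows "complex_of_real ((norm2 f)\<^sup>2) = (\<Sum>i<n. f $ i)"
proof -
  have "f \<in> carrier_vec n" and f: "\<And>i. i < n \<Longrightarrow> f $ i \<in> {0, 1}"
    using assms by (auto simp: indicator_vec_def)
  hence "(norm2 f)\<^sup>2 = (\<Sum>i<n. (cmod (f $ i))\<^sup>2)"
    by (simp add: norm2_def L2_set_def sum_nonneg)
  also have "complex_of_real \<dots> = (\<Sum>i<n. f $ i)"
    unfolding of_real_sum
  proof (intro sum.cong refl)
    fix i assume "i \<in> {..<n}"
    with f[of i] show "complex_of_real ((cmod (f $ i))\<^sup>2) = f $ i" by auto
  qed
  finally show ?thesis .
qed

lemma norm2_eq_0D: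
  assumes "norm2 f = 0" and "f \<in> carrier_vec n" and "i < n"
  shows "f $ i = 0"
  using assms by (simp add: norm2_def L2_set_eq_0_iff)

lemma mat_adjoint_entry:
  assumes "A \<in> carrier_mat n m" and "i < m" and "j < n"
  shows "mat_adjoint A $$ (i, j) = cnj (A $$ (j, i))"
  using assms by (simp add: mat_adjoint_def mat_of_rows_def)

lemma right_inverse_biorthogonal:
  assumes U: "U \<in> carrier_mat n n" and V: "V \<in> carrier_mat n n"
    and UV: "U * mat_adjoint V = 1\<^sub>m n"
  shows "biorthogonal n (\<lambda>i l. U $$ (i, l)) (\<lambda>i l. V $$ (i, l))"
proof -
  have V': "mat_adjoint V \<in> carrier_mat n n"
    using V by (auto simp: mat_adjoint_def)
  have "mat_adjoint V * U = 1\<^sub>m n"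
    by (rule mat_mult_left_right_inverse[OF U V' UV])
  hence "(mat_adjoint V * U) $$ (l, m) = (if l = m then 1 else 0)" if "l < n" "m < n" for l m
    using that by simp
  moreover have "(mat_adjoint V * U) $$ (l, m) = (\<Sum>i<n. cnj (V $$ (i, l)) * U $$ (i, m))"
    if "l < n" "m < n" for l m
    using that U V V' by (simp add: scalar_prod_def mat_adjoint_entry lessThan_atLeast0)
  ultimately show ?thesis
    by (simp add: biorthogonal_def)
qed

lemma diagonal_factorization_entry:
  assumes U: "U \<in> carrier_mat n n" and V: "V \<in> carrier_mat n n" and "i < n" and "j < n"
  shows "(U * mat_diag n lam * mat_adjoint V) $$ (i, j) =
    (\<Sum>l<n. U $$ (i, l) * lam l * cnj (V $$ (j, l)))"
proof -
  have "mat_adjoint V \<in> carrier_mat n n"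
    using V by (auto simp: mat_adjoint_def)
  thus ?thesis
    using assms
    by (simp add: mat_diag_mult_right scalar_prod_def mat_adjoint_entry lessThan_atLeast0 mult.commute)
qed

lemma mult_mat_vec_entry:
  assumes "A \<in> carrier_mat n n" and "x \<in> carrier_vec n" and "i < n"
  shows "(A *\<^sub>v x) $ i = (\<Sum>l<n. A $$ (i, l) * x $ l)"
  using assms by (simp add: scalar_prod_def lessThan_atLeast0)

section \<open>The zero block bound\<close>

theorem theorem3p4:
  fixes n :: nat
    and Gr :: "('v, 'e) pre_digraph"
    and nd :: "nat \<Rightarrow> 'v"
    and B U V :: "complex mat"
    and \<delta> :: complex
    and lam :: "nat \<Rightarrow> complex"
    and \<alpha> \<theta> :: "nat \<Rightarrow> real"
    and f g F G :: "complex vec"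
  assumes n_pos: "0 < n"
    and graph: "wf_digraph Gr"
    and adj: "pseudo_adjacency n Gr nd B"
    and reg: "regular_mat n \<delta> B"
    and U: "U \<in> carrier_mat n n"
    and V: "V \<in> carrier_mat n n"
    and eigvals: "eigenvalue_tuple n B lam"
    and decomp: "B = U * mat_diag n lam * mat_adjoint V"
    and UV: "U * mat_adjoint V = 1\<^sub>m n"
    and ones: "has_ones_pair n U V"
    and polar: "\<And>l. l < n \<Longrightarrow> lam l = of_real (\<alpha> l) * exp (\<i> * of_real (\<theta> l))"
    and angle: "\<And>l. l < n \<Longrightarrow> 0 \<le> \<theta> l \<and> \<theta> l < 2 * pi"
    and f01: "indicator_vec n f"
    and g01: "indicator_vec n g"
    and F: "F \<in> carrier_vec n"
    and G: "G \<in> carrier_vec n"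
    and fF: "f = V *\<^sub>v conjugate F"
    and gG: "g = U *\<^sub>v G"
    and nonneg: "\<And>l. l < n \<Longrightarrow> 0 \<le> F $ l * G $ l * exp (\<i> * of_real (\<theta> l))"
    and denom: "\<delta> - of_real (Min (\<alpha> ` {..<n})) \<noteq> 0"
    and block: "zero_block n B f g"
  shows "complex_of_real ((norm2 f)\<^sup>2 * (norm2 g)\<^sup>2 / real n)
    \<le> - of_real (Min (\<alpha> ` {..<n})) * (\<Sum>l<n. F $ l * G $ l * exp (\<i> * of_real (\<theta> l)))
        / (\<delta> - of_real (Min (\<alpha> ` {..<n})))"
proof -
  let ?u = "\<lambda>i l. U $$ (i, l)" and ?v = "\<lambda>i l. V $$ (i, l)"
  define m where "m = Min (\<alpha> ` {..<n})"
  define w where "w l = F $ l * G $ l * exp (\<i> * of_real (\<theta> l))" for l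
  have uv: "biorthogonal n ?u ?v"
    using right_inverse_biorthogonal[OF U V UV] .
  have B: "B $$ (i, j) = (\<Sum>l<n. ?u i l * lam l * cnj (?v j l))" if "i < n" "j < n" for i j
    using diagonal_factorization_entry[OF U V that] by (simp add: decomp)
  have fc: "f \<in> carrier_vec n" and fi: "\<And>i. i < n \<Longrightarrow> f $ i \<in> {0, 1}"
    and gc: "g \<in> carrier_vec n" and gi: "\<And>i. i < n \<Longrightarrow> g $ i \<in> {0, 1}"
    using f01 g01 by (auto simp: indicator_vec_def)
  have f: "f $ i = (\<Sum>l<n. ?v i l * cnj (F $ l))" if "i < n" for i
    using mult_mat_vec_entry[OF V _ that, of "conjugate F"] F by (simp add: fF)
  have g: "g $ i = (\<Sum>l<n. ?u i l * G $ l)" if "i < n" for i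
    using mult_mat_vec_entry[OF U G that] by (simp add: gG)
  \<comment> \<open>Biorthogonality yields the conjugate of \<open>F $ l\<close>; undoing it leaves \<open>f\<close> alone, which is real.\<close>
  have F_coeff: "F $ l = (\<Sum>i<n. ?u i l * f $ i)" if "l < n" for l
  proof -
    have "cnj (F $ l) = (\<Sum>i<n. cnj (?u i l) * f $ i)"
      using biorthogonal_coefficient[OF biorthogonal_swap[OF uv] that, where g = "\<lambda>i. f $ i"] f
      by simp
    hence "F $ l = (\<Sum>i<n. ?u i l * cnj (f $ i))"
      by (metis (no_types, lifting) cnj_sum complex_cnj_cnj complex_cnj_mult sum.cong)
    also have "\<dots> = (\<Sum>i<n. ?u i l * f $ i)"
      using fi by (intro sum.cong) force+
    finally show ?thesis .
  qed
  have G_coeff: "G $ l = (\<Sum>i<n. cnj (?v i l) * g $ i)" if "l < n" for l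
    using biorthogonal_coefficient[OF uv that, where g = "\<lambda>i. g $ i"] g by simp

  have "(\<Sum>l<n. F $ l * G $ l * lam l) = (\<Sum>i<n. \<Sum>j<n. f $ i * B $$ (i, j) * g $ j)"
    by (rule spectral_bilinear_form[symmetric, OF uv B g F_coeff])
  also have "\<dots> = 0"
  proof (intro sum.neutral ballI)
    fix i j assume "i \<in> {..<n}" "j \<in> {..<n}"
    thus "f $ i * B $$ (i, j) * g $ j = 0"
      using fi[of i] gi[of j] block by (auto simp: zero_block_def)
  qed
  finally have zero: "(\<Sum>l<n. F $ l * G $ l * lam l) = 0" .

  have w_real: "w l = of_real (Re (w l))" and w_nonneg: "0 \<le> Re (w l)" if "l < n" for l
    using nonneg[OF that] by (auto simp: w_def less_eq_complex_def complex_eq_iff)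
  have W_real: "(\<Sum>l<n. w l) = of_real (\<Sum>l<n. Re (w l))"
    unfolding of_real_sum using w_real by (intro sum.cong) auto
  have "complex_of_real (\<Sum>l<n. \<alpha> l * Re (w l)) = (\<Sum>l<n. F $ l * G $ l * lam l)"
    unfolding of_real_sum
  proof (intro sum.cong refl)
    fix l assume "l \<in> {..<n}"
    hence "complex_of_real (\<alpha> l * Re (w l)) = of_real (\<alpha> l) * w l"
      using w_real[of l] by (metis lessThan_iff of_real_mult)
    thus "complex_of_real (\<alpha> l * Re (w l)) = F $ l * G $ l * lam l"
      using \<open>l \<in> {..<n}\<close> by (simp add: w_def polar mult_ac)
  qed
  hence balance: "(\<Sum>l<n. \<alpha> l * Re (w l)) = 0"
    using zero by (metis of_real_eq_0_iff)

  obtain k a b where k: "k < n" and "col U k = a \<cdot>\<^sub>v vec n (\<lambda>_. 1)" "col V k = b \<cdot>\<^sub>v vec n (\<lambda>_. 1)"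
    using ones by (auto simp: has_ones_pair_def)
  have "?u i k = col U k $ i" "?v i k = col V k $ i" if "i < n" for i
    using that k U V by auto
  with \<open>col U k = _\<close> \<open>col V k = _\<close>
  have uk: "?u i k = a" and vk: "?v i k = b" if "i < n" for i
    using that by simp_all
  have "(\<Sum>i<n. cnj (?v i k) * ?u i k) = 1"
    using uv k by (simp add: biorthogonal_def)
  hence ab: "of_nat n * (cnj b * a) = 1"
    using uk vk by simp
  hence "a \<noteq> 0"
    by auto
  have lam_k: "lam k = \<delta>"
    by (rule constant_column_eigenvalue[where B = "\<lambda>i j. B $$ (i, j)", OF uv B _ k uk \<open>a \<noteq> 0\<close>])
      (use reg in \<open>auto simp: regular_mat_def\<close>)
  define c where "c = (norm2 f)\<^sup>2 * (norm2 g)\<^sup>2 / real n"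
  have F_k: "F $ k = a * of_real ((norm2 f)\<^sup>2)"
    unfolding norm2_indicator_vec[OF f01] using F_coeff[OF k] uk by (simp add: sum_distrib_left)
  have G_k: "G $ k = cnj b * of_real ((norm2 g)\<^sup>2)"
    unfolding norm2_indicator_vec[OF g01] using G_coeff[OF k] vk by (simp add: sum_distrib_left)
  have "F $ k * G $ k = (cnj b * a) * of_real ((norm2 f)\<^sup>2 * (norm2 g)\<^sup>2)"
    by (simp add: F_k G_k mult_ac)
  also have "cnj b * a = 1 / of_nat n"
    using ab n_pos by (simp add: field_simps)
  finally have FG_k: "F $ k * G $ k = of_real c"
    by (simp add: c_def)

  have "of_real c \<le> - of_real m * (\<Sum>l<n. w l) / (\<delta> - of_real m)"
  proof (cases "c = 0")
    case True
    hence "norm2 f = 0 \<or> norm2 g = 0"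
      using n_pos by (simp add: c_def)
    hence "F $ l * G $ l = 0" if "l < n" for l
      using F_coeff[OF that] G_coeff[OF that] norm2_eq_0D[OF _ fc] norm2_eq_0D[OF _ gc] by auto
    hence "(\<Sum>l<n. w l) = 0"
      unfolding w_def by (intro sum.neutral ballI) (simp only: lessThan_iff mult_zero_left)
    thus ?thesis
      using True by simp
  next
    case False
    have "0 \<le> c"
      by (simp add: c_def)
    with False have "c > 0"
      by simp
    \<comment> \<open>Only now is \<open>\<delta>\<close>, the eigenvalue at \<open>k\<close>, known to be real and equal to \<open>\<alpha> k\<close>.\<close>
    have phase: "exp (\<i> * complex_of_real (\<theta> k)) = 1"
      using nonneg[OF k] \<open>c > 0\<close>
      by (intro unimodular_eq_1_if_positive_multiple_nonneg[of _ c]) (simp_all add: FG_k)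
    have \<delta>: "\<delta> = of_real (\<alpha> k)" and w_k: "w k = of_real c"
      using polar[OF k] lam_k by (simp_all add: phase w_def FG_k)
    have m_le: "m \<le> \<alpha> l" if "l < n" for l
      using that by (simp add: m_def)
    have "\<alpha> k \<noteq> m"
      using denom by (auto simp: \<delta> m_def)
    with m_le[OF k] have gap: "0 < \<alpha> k - m"
      by simp
    have "(\<alpha> k - m) * Re (w k) \<le> - m * (\<Sum>l<n. Re (w l))"
      using k w_nonneg m_le balance by (intro weighted_sum_zero_bound) auto
    hence "c \<le> - m * (\<Sum>l<n. Re (w l)) / (\<alpha> k - m)"
      using gap unfolding pos_le_divide_eq[OF gap] by (simp add: w_k mult.commute)
    moreover have "- of_real m * (\<Sum>l<n. w l) / (\<delta> - of_real m) =
        of_real (- m * (\<Sum>l<n. Re (w l)) / (\<alpha> k - m))"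
      by (simp add: W_real \<delta>)
    ultimately show ?thesis
      by (simp only: less_eq_complex_def Re_complex_of_real Im_complex_of_real)
  qed
  thus ?thesis
    by (simp only: c_def m_def w_def)
qed

end
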